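(* Let $k$ be an integer with $k\equiv 2 \pmod 4$ and $k \geq 6$, and let $p$ be a prime with $p \equiv 7 \pmod 8$. Let $n$ be a positive integer with $n\equiv 1 \pmod 8$ and $n<p$, such that either $n=1$ or every prime factor of $n$ is congruent to $1 \pmod 4$. Then there are no positive integers $x,y,z$ with $z$ even and $x^2+y^2+z^k=(np)^2$. *)

theory Defs
  imports "HOL-Number_Theory.Cong" "HOL-Computational_Algebra.Primes"
begin

end

theory Submission
  imports Defs "HOL-Number_Theory.Residues"
begin

text \<open>
  Write \<open>k = 2 m\<close> with \<open>m \<ge> 3\<close> odd and \<open>w = z ^ m\<close>, so that
  \<open>x\<^sup>2 + y\<^sup>2 = (n p - w) (n p + w)\<close> with \<open>n p - w \<equiv> 3 (mod 4)\<close>. A prime congruent to 3 modulo 4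
  divides a sum of two squares to an even power, hence some such prime \<open>q\<close> divides both factors,
  and therefore \<open>n p\<close> and \<open>w\<close>. The hypothesis on \<open>n\<close> forces \<open>q = p\<close>, so \<open>p\<close> divides \<open>z\<close> and
  \<open>w \<ge> p ^ 3 > n p\<close>, which is absurd.
\<close>

text \<open>If \<open>q\<close> does not divide \<open>x\<close>, it does not divide
  \<open>y\<close> either. Raising x^2 = -y^2 modulo \<open>q\<close> to the power (q - 1) / 2,
  which is odd because \<open>q mod 4 = 3\<close>, keeps the sign, so Fermat's theorem yields 1 = -1
  modulo an odd prime.\<close>

lemma prime_3_mod_4_dvd_sum_squares:
  fixes q x y :: nat
  assumes "prime q" "q mod 4 = 3" "q dvd x\<^sup>2 + y\<^sup>2"
  shows "q dvd x"
proof (rule ccontr)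
  assume nx: "\<not> q dvd x"
  have ny: "\<not> q dvd y"
  proof
    assume "q dvd y"
    then have "q dvd y\<^sup>2" by (simp add: power2_eq_square)
    with assms(3) have "q dvd x\<^sup>2" using dvd_add_left_iff by blast
    with nx assms(1) show False using prime_dvd_power by blast
  qed
  define j where "j = (q - 1) div 2"
  have j: "2 * j = q - 1" "odd j" using assms(2) unfolding j_def by presburger+
  have fermat: "[int a ^ (2 * j) = 1] (mod int q)" if "\<not> q dvd a" for a
    using fermat_theorem[OF assms(1) that] j(1) cong_int_iff[of "a ^ (q - 1)" 1 q] by simp
  have "int q dvd int x ^ 2 + int y ^ 2"
    using assms(3) by (metis of_nat_add of_nat_dvd_iff of_nat_power)
  then have "[int x ^ 2 = - (int y ^ 2)] (mod int q)"
    by (simp add: cong_iff_dvd_diff)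
  then have "[(int x ^ 2) ^ j = (- (int y ^ 2)) ^ j] (mod int q)"
    by (rule cong_pow)
  then have "[int x ^ (2 * j) = - (int y ^ (2 * j))] (mod int q)"
    using j(2) by (simp add: power_mult)
  moreover have "[- (int y ^ (2 * j)) = - 1] (mod int q)"
    using fermat[OF ny] by (simp add: cong_minus_minus_iff)
  ultimately have "[1 = - 1] (mod int q)"
    using fermat[OF nx] by (meson cong_sym cong_trans)
  then have "int q dvd 2" by (simp add: cong_iff_dvd_diff)
  then have "q \<le> 2" by (auto dest: zdvd_imp_le)
  with assms(2) show False by (cases "q = 2") auto
qed

text \<open>Stripping off a prime factor congruent to 1 modulo 4 leaves the residue 3 unchanged, so
  the descent cannot end at 1 and must meet a prime of the desired kind.\<close>

lemma exists_prime_factor_3_mod_4: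
  fixes a :: nat
  assumes "a mod 4 = 3"
  shows "\<exists>q. prime q \<and> q mod 4 = 3 \<and> q dvd a"
  using assms
proof (induction a rule: less_induct)
  case (less a)
  from less.prems have "a \<noteq> 1" by auto
  then obtain q where q: "prime q" "q dvd a" using prime_factor_nat by blast
  then obtain b where b: "a = q * b" by blast
  have "odd a" using less.prems by presburger
  with q(2) have "odd q" using dvd_trans by blast
  then have "q mod 4 = 1 \<or> q mod 4 = 3" by presburger
  then show ?case
  proof
    assume "q mod 4 = 1"
    then have "b mod 4 = 3"
      using less.prems b by (metis mod_mult_left_eq mult_1)
    moreover have "b < a" using b prime_gt_1_nat[OF q(1)] \<open>odd a\<close> by (simp add: odd_pos)
    ultimately show ?thesis using less.IH b by (metis dvd_mult)
  next
    assume "q mod 4 = 3"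
    with q show ?thesis by blast
  qed
qed

text \<open>Descent instead of counting multiplicities: if a prime \<open>q\<close> congruent to 3
  modulo 4 divides \<open>a\<close> but not \<open>b\<close>, then q^2 divides \<open>a\<close>.
  Dividing \<open>x\<close> and \<open>y\<close> by \<open>q\<close> replaces \<open>a\<close> by a
  / q^2, which is still 3 modulo 4 since q^2 is 1 modulo 4.\<close>

lemma sum_squares_factors_common_prime_3_mod_4:
  fixes a b x y :: nat
  assumes "a mod 4 = 3" "x\<^sup>2 + y\<^sup>2 = a * b"
  shows "\<exists>q. prime q \<and> q mod 4 = 3 \<and> q dvd a \<and> q dvd b"
  using assms
proof (induction a arbitrary: x y rule: less_induct)
  case (less a)
  obtain q where q: "prime q" "q mod 4 = 3" "q dvd a"
    using exists_prime_factor_3_mod_4[OF less.prems(1)] by blast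
  show ?case
  proof (cases "q dvd b")
    case True
    with q show ?thesis by blast
  next
    case False
    have "q dvd x\<^sup>2 + y\<^sup>2" using q(3) less.prems(2) by simp
    then have "q dvd x" "q dvd y"
      using prime_3_mod_4_dvd_sum_squares[OF q(1,2)] by (metis add.commute)+
    then obtain x' y' where xy: "x = q * x'" "y = q * y'" by blast
    obtain c where c: "a = q * c" using q(3) by blast
    have q0: "q > 0" using q(1) by (simp add: prime_gt_0_nat)
    have "q * (q * (x'\<^sup>2 + y'\<^sup>2)) = q * (c * b)"
      using less.prems(2) unfolding xy c by (simp add: power2_eq_square algebra_simps)
    then have cb: "q * (x'\<^sup>2 + y'\<^sup>2) = c * b" using q0 by simp
    \<comment> \<open>One factor \<open>q\<close> is left over on the left-hand side, and it cannot
      be absorbed by \<open>b\<close>.\<close>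
    then have "q dvd c" using False q(1) by (metis dvd_triv_left prime_dvd_mult_iff)
    then obtain d where d: "c = q * d" by blast
    have db: "x'\<^sup>2 + y'\<^sup>2 = d * b" using cb q0 unfolding d by simp
    have "q * q mod 4 = 1" by (subst mod_mult_eq[symmetric]) (simp add: q(2))
    then have d4: "d mod 4 = 3"
      using less.prems(1) unfolding c d by (metis mod_mult_left_eq mult_1 mult.assoc)
    have "1 < q * q" using less_1_mult prime_gt_1_nat[OF q(1)] by blast
    moreover have "d > 0" using d4 by (cases d) auto
    ultimately have "d < a" unfolding c d by (simp flip: mult.assoc)
    from less.IH[OF this d4 db] show ?thesis unfolding c d by auto
  qed
qed

theorem theorem3:
  fixes k p n :: nat
  assumes "[k = 2] (mod 4)" and "k \<ge> 6"
    and "prime p" and "[p = 7] (mod 8)"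
    and "n > 0" and "[n = 1] (mod 8)" and "n < p"
    and "n = 1 \<or> (\<forall>q \<in> prime_factors n. [q = 1] (mod 4))"
  shows "\<not> (\<exists>x y z :: nat. x > 0 \<and> y > 0 \<and> z > 0 \<and> even z \<and>
            x\<^sup>2 + y\<^sup>2 + z ^ k = (n * p)\<^sup>2)"
proof
  assume "\<exists>x y z :: nat. x > 0 \<and> y > 0 \<and> z > 0 \<and> even z \<and>
            x\<^sup>2 + y\<^sup>2 + z ^ k = (n * p)\<^sup>2"
  then obtain x y z :: nat where "x > 0" "z > 0" "even z"
    and eq: "x\<^sup>2 + y\<^sup>2 + z ^ k = (n * p)\<^sup>2" by blast
  define m where "m = k div 2"
  have k: "k = m * 2" and "m \<ge> 3"
    using assms(1,2) unfolding m_def cong_def by presburger+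
  define w where "w = z ^ m"
  have eq': "x\<^sup>2 + y\<^sup>2 + w\<^sup>2 = (n * p)\<^sup>2" using eq unfolding w_def k by (simp add: power_mult)
  moreover have "x\<^sup>2 > 0" using \<open>x > 0\<close> by simp
  ultimately have "w\<^sup>2 < (n * p)\<^sup>2" by linarith
  then have w_less: "w < n * p" by (rule power_less_imp_less_base) simp
  \<comment> \<open>By \<open>w_less\<close> the subtraction on naturals is not truncated.\<close>
  define a where "a = n * p - w"
  have np: "n * p = a + w" using w_less by (simp add: a_def)
  have "x\<^sup>2 + y\<^sup>2 = a * (n * p + w)"
    using eq' unfolding np by (simp add: power2_eq_square algebra_simps)
  moreover have "a mod 4 = 3"
  proof -
    have "2 ^ 2 dvd z ^ m"
      using \<open>even z\<close> \<open>m \<ge> 3\<close> by (intro dvd_power_le) auto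
    then have "w mod 4 = 0" by (simp add: w_def)
    moreover have "[n = 1] (mod 4)" "[p = 7] (mod 4)"
      using assms(4,6) by (auto elim: cong_dvd_modulus_nat)
    then have "n mod 4 = 1" "p mod 4 = 3" by (simp_all add: cong_def)
    then have "n * p mod 4 = 3" by (metis mod_mult_left_eq mult_1)
    ultimately show ?thesis using mod_add_right_eq[of a w 4] unfolding np by simp
  qed
  ultimately obtain q where q: "prime q" "q mod 4 = 3" "q dvd a" "q dvd n * p + w"
    using sum_squares_factors_common_prime_3_mod_4 by blast
  \<comment> \<open>Adding the two factors eliminates \<open>w\<close>, and the odd prime
    \<open>q\<close> can be cancelled against the 2.\<close>
  have "q dvd a + (n * p + w)" using q by simp
  moreover have "a + (n * p + w) = 2 * (n * p)" using np by simp
  moreover have "\<not> q dvd 2" using q(1,2) primes_dvd_imp_eq[OF q(1) two_is_prime_nat] by auto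
  ultimately have q_np: "q dvd n * p" using q(1) by (metis prime_dvd_mult_iff)
  then have "q dvd w" using q(3) np by (metis dvd_add_right_iff)
  then have "q dvd z" using q(1) prime_dvd_power w_def by blast
  have "\<not> q dvd n"
  proof
    assume "q dvd n"
    then have "q \<in> prime_factors n" using q(1) \<open>n > 0\<close> by (simp add: in_prime_factors_iff)
    \<comment> \<open>For \<open>n = 1\<close> the set of prime factors is empty, so that
      alternative is contradictory here.\<close>
    with assms(8) have "[q = 1] (mod 4)" by auto
    with q(2) show False by (simp add: cong_def)
  qed
  with q_np q(1) have "q dvd p" by (simp add: prime_dvd_mult_iff)
  with q(1) assms(3) have "q = p" by (simp add: primes_dvd_imp_eq)
  with \<open>q dvd z\<close> \<open>z > 0\<close> have "p \<le> z" by (simp add: dvd_imp_le)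
  \<comment> \<open>Comparing squares is enough: n p < p^2 \<le> z^2 \<le> z^m = w contradicts
    \<open>w_less\<close>.\<close>
  have "n * p < p ^ 2" using assms(5,7) by (simp add: power2_eq_square)
  also have "\<dots> \<le> z ^ 2" using \<open>p \<le> z\<close> by (simp add: power_mono)
  also have "\<dots> \<le> w" unfolding w_def using \<open>m \<ge> 3\<close> \<open>z > 0\<close> by (intro power_increasing) auto
  finally show False using w_less by simp
qed

end
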